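(* For every integer $n>0$, the polynomial $\Phi(n;t)\in\mathbb{Z}[t]$ is a $3$-special polynomial.
   Context: Let $f_1=1$, $f_2=2$ and $f_i=f_{i-1}+f_{i-2}$ for $i>2$ be the Fibonacci numbers (with this indexing). A Fibonacci partition of a positive integer $n$ is a representation of $n$ as an unordered sum of distinct Fibonacci numbers $f_i$ ($i\geqslant 1$), called the parts of the partition. Let $\Phi_h(n)$ be the number of Fibonacci partitions of $n$ with exactly $h$ parts, and set $$\Phi(n;t):=\sum_{h>0}\Phi_h(n)t^h.$$ Let $K:=\mathbb{Z}[T]/(T^3-1)$. For $g(t)=\sum_{h\geqslant 0}a_ht^h\in\mathbb{Z}[t]$ and $i\in\{0,1,2\}$ put $R_i(g(t)):=\sum_{h\equiv i \bmod 3}a_h$, and define $R:\mathbb{Z}[t]\to K$ by $R(g(t)):=R_0(g(t))+R_1(g(t))T+R_2(g(t))T^2$. An element $a+bT+cT^2\in K$ (with $a,b,c\in\mathbb{Z}$) is called special if either $a=b=c$, or $|a-b|+|a-c|+|b-c|=2$. A polynomial $g(t)\in\mathbb{Z}[t]$ is called $3$-special if $R(g(t))$ is a special element of $K$. *)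

theory Defs
  imports "HOL-Number_Theory.Fib" "HOL-Computational_Algebra.Polynomial"
begin

text \<open>The library has \<open>fib 1 = fib 2 = 1\<close>, whereas here
  \<open>f\<^sub>1 = 1\<close>, \<open>f\<^sub>2 = 2\<close>; hence the shift.\<close>

definition fibo :: "nat \<Rightarrow> nat" where
  "fibo i = fib (i + 1)"

lemma fibo_recurrence: "fibo 1 = 1" "fibo 2 = 2" "i > 2 \<Longrightarrow> fibo i = fibo (i - 1) + fibo (i - 2)"
proof -
  show "fibo 1 = 1" "fibo 2 = 2" by (simp_all add: fibo_def numeral_eq_Suc)
next
  assume "i > 2"
  then obtain j where "i = Suc (Suc j)" by (metis Suc_1 Suc_lessE less_imp_Suc_add)
  then show "fibo i = fibo (i - 1) + fibo (i - 2)" by (simp add: fibo_def)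
qed

definition fib_partitions :: "nat \<Rightarrow> nat set set" where
  "fib_partitions n = {P. finite P \<and> P \<subseteq> fibo ` {1..} \<and> \<Sum>P = n}"

definition Phi_parts :: "nat \<Rightarrow> nat \<Rightarrow> nat" where
  "Phi_parts h n = card {P \<in> fib_partitions n. card P = h}"

text \<open>All parts are positive, so a partition of \<open>n\<close> has at most \<open>n\<close> parts and the sum over
  all \<open>h > 0\<close> may be cut off at \<open>n\<close>; see \<open>coeff_Phi\<close> below.\<close>

definition Phi :: "nat \<Rightarrow> int poly" where
  "Phi n = (\<Sum>h = 1..n. monom (int (Phi_parts h n)) h)"

lemma fib_partition_subset:
  assumes "P \<in> fib_partitions n"
  shows "P \<subseteq> {1..n}"
proof
  fix x assume x: "x \<in> P"
  from assms have P: "finite P" "P \<subseteq> fibo ` {1..}" "\<Sum>P = n"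
    by (auto simp: fib_partitions_def)
  from x P(2) have "x > 0" by (auto simp: fibo_def fib_neq_0_nat)
  moreover have "x \<le> n" using member_le_sum[of x P "\<lambda>x. x"] x P by simp
  ultimately show "x \<in> {1..n}" by simp
qed

lemma finite_fib_partitions: "finite (fib_partitions n)"
  by (rule finite_subset[of _ "Pow {1..n}"]) (use fib_partition_subset in auto)

lemma Phi_parts_eq_0:
  assumes "h > n"
  shows "Phi_parts h n = 0"
proof -
  have "card P \<le> n" if "P \<in> fib_partitions n" for P
    using card_mono[OF _ fib_partition_subset[OF that]] by simp
  then have "{P \<in> fib_partitions n. card P = h} = {}" using assms by force
  then show ?thesis unfolding Phi_parts_def by (simp only: card.empty)
qed

lemma coeff_Phi: "coeff (Phi n) h = (if h > 0 then int (Phi_parts h n) else 0)"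
  by (auto simp: Phi_def coeff_sum Phi_parts_eq_0)

definition K_modulus :: "int poly" where
  "K_modulus = monom 1 3 - 1"

definition K_rel :: "int poly \<Rightarrow> int poly \<Rightarrow> bool" where
  "K_rel p q \<longleftrightarrow> K_modulus dvd p - q"

quotient_type K = "int poly" / K_rel
proof (rule equivpI)
  show "reflp K_rel" by (simp add: reflp_def K_rel_def)
  show "symp K_rel"
    unfolding symp_def K_rel_def by (metis dvd_minus_iff minus_diff_eq)
  show "transp K_rel"
    unfolding transp_def K_rel_def using dvd_add by fastforce
qed

instantiation K :: comm_ring_1
begin

lift_definition zero_K :: K is 0 .
lift_definition one_K :: K is 1 .
lift_definition uminus_K :: "K \<Rightarrow> K" is uminus
  by (simp add: K_rel_def) (metis dvd_minus_iff minus_diff_eq minus_diff_minus)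
lift_definition plus_K :: "K \<Rightarrow> K \<Rightarrow> K" is "(+)"
  by (simp add: K_rel_def add_diff_add)
lift_definition minus_K :: "K \<Rightarrow> K \<Rightarrow> K" is "(-)"
  unfolding K_rel_def by (metis diff_diff_eq2 diff_diff_add add.commute diff_add_eq dvd_diff)
lift_definition times_K :: "K \<Rightarrow> K \<Rightarrow> K" is "(*)"
proof -
  fix p p' q q' :: "int poly"
  assume "K_rel p p'" "K_rel q q'"
  moreover have "p * q - p' * q' = (p - p') * q + p' * (q - q')"
    by (simp add: algebra_simps)
  ultimately show "K_rel (p * q) (p' * q')" by (simp add: K_rel_def)
qed

lemma K_modulus_nontrivial: "\<not> K_modulus dvd 1"
proof
  assume "K_modulus dvd 1"
  then have "poly K_modulus 1 dvd poly 1 1" by (elim dvdE) (metis dvd_triv_left poly_mult)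
  then show False by (simp add: K_modulus_def poly_monom)
qed

instance
proof
  show "(0 :: K) \<noteq> 1"
    by transfer (use K_modulus_nontrivial in \<open>auto simp: K_rel_def\<close>)
qed (transfer; simp add: K_rel_def algebra_simps)+

end

lift_definition K_T :: K is "monom 1 1" .

lemma K_T_cubed: "K_T ^ 3 = 1"
proof -
  have "K_T ^ 3 = K_T * K_T * K_T" by (simp add: power3_eq_cube)
  also have "\<dots> = 1"
    by transfer (simp add: K_rel_def K_modulus_def mult_monom numeral_3_eq_3)
  finally show ?thesis .
qed

definition K_elem :: "int \<Rightarrow> int \<Rightarrow> int \<Rightarrow> K" where
  "K_elem a b c = of_int a + of_int b * K_T + of_int c * K_T ^ 2"

lemma K_elem_eq_abs: "K_elem a b c = abs_K [:a, b, c:]"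
proof -
  have of_int: "of_int k = abs_K [:k:]" for k
  proof (induction k rule: int_induct[where k = 0])
    case base
    show ?case by (simp add: zero_K.abs_eq)
  next
    case (step1 i)
    then show ?case by (simp add: one_K.abs_eq plus_K.abs_eq one_pCons)
  next
    case (step2 i)
    then show ?case by (simp add: one_K.abs_eq minus_K.abs_eq one_pCons)
  qed
  show ?thesis
    by (simp add: K_elem_def of_int K_T.abs_eq power2_eq_square times_K.abs_eq plus_K.abs_eq
        mult_monom monom_altdef numeral_eq_Suc)
qed

lemma K_elem_inject: "K_elem a b c = K_elem a' b' c' \<longleftrightarrow> a = a' \<and> b = b' \<and> c = c'"
proof
  assume "K_elem a b c = K_elem a' b' c'"
  then have "K_modulus dvd [:a - a', b - b', c - c':]"
    by (simp add: K_elem_eq_abs K.abs_eq_iff K_rel_def)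
  moreover have "degree K_modulus = 3"
  proof -
    have "K_modulus = [:-1, 0, 0, 1:]"
      by (simp add: K_modulus_def monom_altdef one_pCons numeral_eq_Suc)
    then show ?thesis by (metis degree_pCons_eq_if degree_0 one_neq_zero pCons_eq_0_iff numeral_3_eq_3)
  qed
  moreover have "degree [:a - a', b - b', c - c':] \<le> 2" by (simp add: degree_pCons_eq_if)
  ultimately have "[:a - a', b - b', c - c':] = 0" using dvd_imp_degree_le by fastforce
  then show "a = a' \<and> b = b' \<and> c = c'" by simp
qed simp

definition residue_sum :: "nat \<Rightarrow> int poly \<Rightarrow> int" where
  "residue_sum i g = (\<Sum>h | h \<le> degree g \<and> h mod 3 = i. coeff g h)"

definition R_map :: "int poly \<Rightarrow> K" where
  "R_map g = K_elem (residue_sum 0 g) (residue_sum 1 g) (residue_sum 2 g)"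

definition special :: "K \<Rightarrow> bool" where
  "special x \<longleftrightarrow> (\<exists>a b c. x = K_elem a b c \<and>
     (a = b \<and> b = c \<or> \<bar>a - b\<bar> + \<bar>a - c\<bar> + \<bar>b - c\<bar> = 2))"

definition three_special :: "int poly \<Rightarrow> bool" where
  "three_special g \<longleftrightarrow> special (R_map g)"

end

theory Submission
  imports Defs
begin

text \<open>Let \<open>\<omega>\<close> be a primitive cube root of unity. Then \<open>g\<close> is 3-special iff \<open>|g(\<omega>)|\<close> is 0 or 1.
  Let \<open>P\<^sub>k(m)\<close> be the value at \<open>\<omega>\<close> of the generating polynomial of the partitions of \<open>m\<close> into parts
  among \<open>f\<^sub>1, \<dots>, f\<^sub>k\<close>. For \<open>r < f\<^sub>k\<close> the vector \<open>(P\<^sub>k(r), P\<^sub>k(r + f\<^sub>k\<^sub>+\<^sub>1))\<close> arises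
  from such a vector for \<open>k - 2\<close> or \<open>k - 3\<close> by one of three matrices, and these matrices map the
  four lines spanned by \<open>(1, 0)\<close>, \<open>(0, 1)\<close>, \<open>(1, \<omega>\<^sup>2)\<close>, \<open>(1, -\<omega>)\<close> to each other or to zero,
  scaling these spanning vectors by numbers of modulus 1.\<close>

section \<open>Fibonacci partitions with bounded parts\<close>

lemma fibo_0 [simp]: "fibo 0 = 1" and fibo_Suc_0 [simp]: "fibo (Suc 0) = 1"
  and fibo_Suc_Suc: "fibo (Suc (Suc k)) = fibo (Suc k) + fibo k"
  by (simp_all add: fibo_def)

lemma fibo_pos: "fibo k > 0"
  by (simp add: fibo_def fib_neq_0_nat)

lemma fibo_less_Suc: "i > 0 \<Longrightarrow> fibo i < fibo (Suc i)"
  by (cases i) (simp_all add: fibo_Suc_Suc fibo_pos)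

text \<open>Index 0 has to stay out, because \<open>fibo 0\<close> and \<open>fibo 1\<close> are
  both 1.\<close>

lemma fibo_strict_mono: "strict_mono_on {1..} fibo"
proof (rule strict_mono_onI)
  fix i j :: nat
  assume "i \<in> {1..}" "i < j"
  then show "fibo i < fibo j"
    using \<open>i < j\<close>
  proof (induction j)
    case (Suc j)
    then show ?case
      using fibo_less_Suc[of j] by (cases "i = j") auto
  qed simp
qed

text \<open>Guarantees that only indices up to \<open>n\<close> can occur in a partition of
  \<open>n\<close>.\<close>

lemma fibo_ge: "k \<le> fibo k"
proof (induction k)
  case (Suc k)
  then show ?case using fibo_less_Suc[of k] by (cases "k = 0") auto
qed simp

text \<open>Partitions are encoded by indices instead of values, which allows induction on the
  largest admissible index.\<close>

definition index_sets :: "nat \<Rightarrow> nat \<Rightarrow> nat set set" where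
  "index_sets k n = {S. S \<subseteq> {1..k} \<and> sum fibo S = n}"

text \<open>This is the coefficient of x^n in the product of the factors 1 + t x^(f_i) for 1 \<le> i
  \<le> k.\<close>

definition bounded_gf :: "'a::comm_ring_1 \<Rightarrow> nat \<Rightarrow> nat \<Rightarrow> 'a" where
  "bounded_gf t k n = (\<Sum>S\<in>index_sets k n. t ^ card S)"

lemma finite_index_sets: "finite (index_sets k n)"
  by (rule finite_subset[of _ "Pow {1..k}"]) (auto simp: index_sets_def)

lemma bounded_gf_0: "bounded_gf t 0 n = (if n = 0 then 1 else 0)"
proof -
  have "index_sets 0 n = (if n = 0 then {{}} else {})"
    by (auto simp: index_sets_def)
  then show ?thesis by (simp add: bounded_gf_def)
qed

text \<open>Split by membership of \<open>Suc k\<close>; deleting it costs one factor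
  \<open>t\<close>. The guard matters because truncated subtraction would turn a too small
  \<open>n\<close> into 0, where the empty set counts.\<close>

lemma bounded_gf_Suc:
  "bounded_gf t (Suc k) n = bounded_gf t k n +
     (if fibo (Suc k) \<le> n then t * bounded_gf t k (n - fibo (Suc k)) else 0)"
proof -
  define B where "B = {S \<in> index_sets (Suc k) n. Suc k \<in> S}"
  have fin: "finite B" unfolding B_def using finite_index_sets by simp
  have split: "index_sets (Suc k) n = index_sets k n \<union> B"
    unfolding B_def index_sets_def by (auto simp: atLeastAtMostSuc_conv)
  have disj: "index_sets k n \<inter> B = {}"
    by (auto simp: B_def index_sets_def)
  have "sum (\<lambda>S. t ^ card S) B =
      (if fibo (Suc k) \<le> n then t * bounded_gf t k (n - fibo (Suc k)) else 0)"
  proof (cases "fibo (Suc k) \<le> n")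
    case True
    have finS: "finite S \<and> Suc k \<notin> S" if "S \<in> index_sets k m" for S m
      using that finite_subset[of S "{1..k}"] by (auto simp: index_sets_def)
    have "B = insert (Suc k) ` index_sets k (n - fibo (Suc k))"
    proof (intro equalityI subsetI)
      fix S assume "S \<in> B"
      then have S: "S \<subseteq> {1..Suc k}" "sum fibo S = n" "Suc k \<in> S"
        by (auto simp: B_def index_sets_def)
      then have "finite S" using finite_subset by blast
      then have "S - {Suc k} \<in> index_sets k (n - fibo (Suc k))"
        using S by (auto simp: index_sets_def sum_diff1_nat)
      then show "S \<in> insert (Suc k) ` index_sets k (n - fibo (Suc k))"
        using S(3) by (metis image_eqI insert_Diff)
    next
      fix S assume "S \<in> insert (Suc k) ` index_sets k (n - fibo (Suc k))"
      then obtain S' where S': "S = insert (Suc k) S'" "S' \<in> index_sets k (n - fibo (Suc k))"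
        by blast
      with finS[OF S'(2)] True show "S \<in> B"
        by (auto simp: B_def index_sets_def)
    qed
    moreover have "inj_on (insert (Suc k)) (index_sets k m)" for m
      using finS by (intro inj_onI) (metis insert_ident)
    ultimately have "sum (\<lambda>S. t ^ card S) B =
        (\<Sum>S\<in>index_sets k (n - fibo (Suc k)). t ^ card (insert (Suc k) S))"
      by (simp add: sum.reindex)
    also have "\<dots> = (\<Sum>S\<in>index_sets k (n - fibo (Suc k)). t * t ^ card S)"
      using finS by (intro sum.cong) auto
    finally show ?thesis using True by (simp add: bounded_gf_def sum_distrib_left)
  next
    case False
    have "fibo (Suc k) \<le> n" if "S \<in> B" for S
      using that member_le_sum[of "Suc k" S fibo] finite_subset[of S "{1..Suc k}"]
      by (auto simp: B_def index_sets_def)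
    with False have "B = {}" by blast
    with False show ?thesis by simp
  qed
  then show ?thesis
    unfolding bounded_gf_def split
    by (subst sum.union_disjoint) (use finite_index_sets fin disj in auto)
qed

text \<open>Indeed \<open>f\<^sub>1 + \<dots> + f\<^sub>k = f\<^sub>k\<^sub>+\<^sub>2 - 2\<close>.\<close>

lemma bounded_gf_eq_0:
  assumes "fibo (Suc (Suc k)) \<le> Suc n"
  shows "bounded_gf t k n = 0"
  using assms
proof (induction k arbitrary: n)
  case (Suc k)
  have "bounded_gf t k n = 0"
    using Suc.prems fibo_Suc_Suc[of "Suc k"] by (intro Suc.IH) simp
  moreover have "bounded_gf t k (n - fibo (Suc k)) = 0" if "fibo (Suc k) \<le> n"
    using Suc.prems fibo_Suc_Suc[of "Suc k"] that by (intro Suc.IH) simp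
  ultimately show ?case by (simp add: bounded_gf_Suc)
qed (simp add: bounded_gf_0 fibo_Suc_Suc)

lemma bounded_gf_Suc_less: "n < fibo (Suc k) \<Longrightarrow> bounded_gf t (Suc k) n = bounded_gf t k n"
  by (simp add: bounded_gf_Suc)

lemma bounded_gf_Suc_add:
  "bounded_gf t (Suc k) (n + fibo (Suc k)) = bounded_gf t k (n + fibo (Suc k)) + t * bounded_gf t k n"
  by (simp add: bounded_gf_Suc)

text \<open>The target is n + f_(k+1) + f_(k+2), beyond the reach of the first k+1 parts, so f_(k+2)
  must be used. What remains splits by whether f_(k+1) is used.\<close>

lemma bounded_gf_Suc_Suc_add:
  "bounded_gf t (Suc (Suc k)) (n + fibo (Suc (Suc (Suc k)))) =
     t\<^sup>2 * bounded_gf t k n + t * bounded_gf t k (n + fibo (Suc k))"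
proof -
  have "bounded_gf t (Suc (Suc k)) (n + fibo (Suc (Suc (Suc k)))) =
      bounded_gf t (Suc (Suc k)) ((n + fibo (Suc k)) + fibo (Suc (Suc k)))"
    using fibo_Suc_Suc[of "Suc k"] by (simp add: algebra_simps)
  also have "\<dots> = bounded_gf t (Suc k) (n + fibo (Suc k) + fibo (Suc (Suc k)))
      + t * bounded_gf t (Suc k) (n + fibo (Suc k))"
    by (rule bounded_gf_Suc_add)
  also have "bounded_gf t (Suc k) (n + fibo (Suc k) + fibo (Suc (Suc k))) = 0"
    by (rule bounded_gf_eq_0) (use fibo_Suc_Suc[of "Suc k"] in simp)
  finally show ?thesis
    by (simp add: bounded_gf_Suc_add algebra_simps power2_eq_square)
qed

section \<open>Evaluation at a primitive cube root of unity\<close>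

definition omega :: complex where
  "omega = Complex (- 1 / 2) (sqrt 3 / 2)"

lemma omega_square: "omega\<^sup>2 = - 1 - omega"
  by (simp add: omega_def power2_eq_square complex_eq_iff)

lemma omega_mult_omega: "omega * omega = - 1 - omega"
  using omega_square by (simp add: power2_eq_square)

text \<open>Handles right-nested products, so that every polynomial in \<open>omega\<close> reduces
  to a linear one.\<close>

lemma omega_mult_omega_left: "omega * (omega * z) = - z - omega * z"
  using omega_mult_omega by (metis left_diff_distrib mult.assoc mult_minus1)

lemmas omega_simps = omega_square omega_mult_omega omega_mult_omega_left

lemma omega_cubed: "omega ^ 3 = 1"
  by (simp add: power3_eq_cube omega_simps algebra_simps)

lemma cmod_omega: "cmod omega = 1"
  by (simp add: omega_def cmod_def power_divide)

section \<open>Four lines permuted or collapsed by the recursion\<close>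

definition on_unit_line :: "complex \<Rightarrow> complex \<Rightarrow> bool" where
  "on_unit_line x y \<longleftrightarrow> (\<exists>u. cmod u \<in> {0, 1} \<and>
     (x, y) \<in> {(u, 0), (0, u), (u, omega\<^sup>2 * u), (u, - omega * u)})"

lemma on_unit_lineI:
  assumes "cmod u \<in> {0, 1}"
    and "(x, y) \<in> {(u, 0), (0, u), (u, omega\<^sup>2 * u), (u, - omega * u)}"
  shows "on_unit_line x y"
  using assms unfolding on_unit_line_def by blast

lemma on_unit_line_cases:
  assumes "on_unit_line x y"
  obtains u where "cmod u \<in> {0, 1}" "x = u" "y = 0"
    | u where "cmod u \<in> {0, 1}" "x = 0" "y = u"
    | u where "cmod u \<in> {0, 1}" "x = u" "y = omega\<^sup>2 * u"
    | u where "cmod u \<in> {0, 1}" "x = u" "y = - omega * u"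
  using assms unfolding on_unit_line_def by blast

lemma on_unit_line_cmod: "on_unit_line x y \<Longrightarrow> cmod x \<in> {0, 1}"
  by (auto simp: on_unit_line_def)

text \<open>The matrix fixes the line of (0, 1) and cycles those of (1, 0), (1,
  \<open>omega\<^sup>2\<close>), (1, \<open>- omega\<close>) in this order.\<close>

lemma on_unit_line_step_skip:
  assumes "on_unit_line x y"
  shows "on_unit_line x (omega\<^sup>2 * x + omega * y)"
  using assms
proof (cases rule: on_unit_line_cases)
  case (1 u)
  then show ?thesis by (intro on_unit_lineI[of u]) auto
next
  case (2 u)
  then show ?thesis by (intro on_unit_lineI[of "omega * u"]) (auto simp: norm_mult cmod_omega)
next
  case (3 u)
  have "omega\<^sup>2 * u + omega * (omega\<^sup>2 * u) = - omega * u"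
    by (simp add: omega_simps algebra_simps)
  with 3 show ?thesis by (intro on_unit_lineI[of u]) auto
next
  case (4 u)
  then show ?thesis by (intro on_unit_lineI[of u]) (auto simp: omega_simps algebra_simps)
qed

text \<open>The matrix fixes the line of (1, 0) and cycles those of (0, 1), (1,
  \<open>omega\<^sup>2\<close>), (1, \<open>- omega\<close>) in this order.\<close>

lemma on_unit_line_step_take:
  assumes "on_unit_line x y"
  shows "on_unit_line (omega * x + y) (omega\<^sup>2 * y)"
  using assms
proof (cases rule: on_unit_line_cases)
  case (1 u)
  then show ?thesis by (intro on_unit_lineI[of "omega * u"]) (auto simp: norm_mult cmod_omega)
next
  case (2 u)
  then show ?thesis by (intro on_unit_lineI[of u]) auto
next
  case (3 u)
  have "omega * u + omega\<^sup>2 * u = - u" "omega\<^sup>2 * (omega\<^sup>2 * u) = - omega * (- u)"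
    by (simp_all add: omega_simps algebra_simps)
  with 3 show ?thesis by (intro on_unit_lineI[of "- u"]) auto
next
  case (4 u)
  then show ?thesis by (intro on_unit_lineI[of "- u"]) (auto simp: omega_simps algebra_simps)
qed

text \<open>The matrix has rank one: its image is the line of (1, \<open>omega\<^sup>2\<close>) and
  its kernel that of (1, \<open>- omega\<close>). This collapse is where modulus 0 enters.\<close>

lemma on_unit_line_step_singular:
  assumes "on_unit_line x y"
  shows "on_unit_line (omega * x + y) (omega\<^sup>2 * (omega * x + y))"
proof -
  have "cmod (omega * x + y) \<in> {0, 1}"
    using assms
  proof (cases rule: on_unit_line_cases)
    case (3 u)
    then have "omega * x + y = - u" by (simp add: omega_simps algebra_simps)
    with 3 show ?thesis by simp
  qed (auto simp: norm_mult cmod_omega)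
  then show ?thesis by (rule on_unit_lineI) simp
qed

lemma on_unit_line_bounded_gf:
  assumes "r < fibo k"
  shows "on_unit_line (bounded_gf omega k r) (bounded_gf omega k (r + fibo (Suc k)))"
  using assms
proof (induction k arbitrary: r rule: less_induct)
  case (less k)
  let ?P = "bounded_gf omega"
  consider "k \<le> 1" | j where "k = Suc (Suc j)"
    by (metis One_nat_def Suc_le_eq le_zero_eq linorder_not_less not0_implies_Suc not_less_eq_eq)
  then show ?case
  proof cases
    case 1
    \<comment> \<open>Since f_0 = f_1 = 1, only r = 0 occurs, and the vector is (1, 0).\<close>
    then have "k = 0 \<or> k = Suc 0" by auto
    with less.prems have "r = 0" and "?P k r = 1" and "?P k (r + fibo (Suc k)) = 0"
      by (auto simp: bounded_gf_0 bounded_gf_Suc fibo_Suc_Suc)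
    then show ?thesis by (intro on_unit_lineI[of 1]) auto
  next
    case (2 j)
    have X: "?P k r = ?P (Suc j) r"
      using less.prems 2 by (simp add: bounded_gf_Suc_less)
    have Y: "?P k (r + fibo (Suc k)) = omega\<^sup>2 * ?P j r + omega * ?P j (r + fibo (Suc j))"
      unfolding 2 by (rule bounded_gf_Suc_Suc_add)
    \<comment> \<open>The range of \<open>r\<close> selects the matrix: skip, singular and take,
      respectively.\<close>
    consider "r < fibo j" | "fibo j \<le> r" "r < fibo (Suc j)" | "fibo (Suc j) \<le> r"
      by linarith
    then show ?thesis
    proof cases
      case a: 1
      then have "r < fibo (Suc j)"
        using fibo_less_Suc[of j] by (cases j) auto
      then have "?P (Suc j) r = ?P j r" by (rule bounded_gf_Suc_less)
      then show ?thesis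
        using on_unit_line_step_skip[OF less.IH[of j r]] a 2 X Y by simp
    next
      case b: 2
      \<comment> \<open>For j = 0 the range would be empty, as f_0 = f_1.\<close>
      then obtain i where i: "j = Suc i" by (cases j) auto
      define s where "s = r - fibo j"
      have r: "r = s + fibo (Suc i)" using b i by (simp add: s_def)
      have s: "s < fibo i" using b i r by (simp add: fibo_Suc_Suc)
      have "?P (Suc j) r = ?P j r" using b by (simp add: bounded_gf_Suc_less)
      moreover have "?P j r = omega * ?P i s + ?P i (s + fibo (Suc i))"
        unfolding i r bounded_gf_Suc_add by simp
      \<comment> \<open>Here r + f_(j+1) \<ge> f_j + f_(j+1) = f_(j+2), out of reach of the first j
        parts. Both components thus depend on \<open>?P j r\<close> alone, which makes the matrix
        singular.\<close>
      moreover have "?P j (r + fibo (Suc j)) = 0"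
        by (rule bounded_gf_eq_0) (use b in \<open>simp add: fibo_Suc_Suc\<close>)
      moreover have "on_unit_line (?P i s) (?P i (s + fibo (Suc i)))"
        using less.IH[of i s] s 2 i by simp
      ultimately show ?thesis
        using on_unit_line_step_singular[of "?P i s" "?P i (s + fibo (Suc i))"] X Y by simp
    next
      case c: 3
      define s where "s = r - fibo (Suc j)"
      have r: "r = s + fibo (Suc j)" using c by (simp add: s_def)
      have s: "s < fibo j" using less.prems 2 r by (simp add: fibo_Suc_Suc)
      have "?P (Suc j) r = omega * ?P j s + ?P j (s + fibo (Suc j))"
        unfolding r bounded_gf_Suc_add by simp
      moreover have "?P j (r + fibo (Suc j)) = 0"
      proof (rule bounded_gf_eq_0)
        have "fibo j \<le> fibo (Suc j)" using fibo_less_Suc[of j] by (cases j) auto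
        then show "fibo (Suc (Suc j)) \<le> Suc (r + fibo (Suc j))"
          using c by (simp add: fibo_Suc_Suc)
      qed
      moreover have "on_unit_line (?P j s) (?P j (s + fibo (Suc j)))"
        using less.IH[of j s] s 2 by simp
      ultimately show ?thesis
        using on_unit_line_step_take[of "?P j s" "?P j (s + fibo (Suc j))"] X Y r by simp
    qed
  qed
qed

section \<open>The generating polynomial\<close>

text \<open>A part f_i \<le> n has i \<le> n \<le> k by \<open>fibo_ge\<close>, so the bound on
  indices loses no partition.\<close>

lemma fib_partitions_eq_image:
  assumes "n \<le> k"
  shows "fib_partitions n = image fibo ` index_sets k n"
proof (intro equalityI subsetI)
  fix Q assume Q: "Q \<in> fib_partitions n"
  then have sub: "Q \<subseteq> fibo ` {1..}" and sum: "\<Sum>Q = n"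
    by (auto simp: fib_partitions_def)
  \<comment> \<open>Restricting to positive indices keeps the value 1 from being indexed
    twice.\<close>
  define S where "S = {i \<in> {1..}. fibo i \<in> Q}"
  have QS: "Q = fibo ` S" using sub by (auto simp: S_def)
  have "i \<le> n" if "i \<in> S" for i
    using fib_partition_subset[OF Q] fibo_ge[of i] that by (fastforce simp: S_def)
  then have "S \<subseteq> {1..k}" using assms by (fastforce simp: S_def)
  moreover have "inj_on fibo S"
    using strict_mono_on_imp_inj_on[OF fibo_strict_mono] by (rule inj_on_subset) (auto simp: S_def)
  then have "sum fibo S = n" using sum QS by (simp add: sum.reindex)
  ultimately have "S \<in> index_sets k n" by (simp add: index_sets_def)
  with QS show "Q \<in> image fibo ` index_sets k n" by blast
next
  fix Q assume "Q \<in> image fibo ` index_sets k n"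
  then obtain S where S: "Q = fibo ` S" "S \<subseteq> {1..k}" "sum fibo S = n"
    by (auto simp: index_sets_def)
  have "inj_on fibo S"
    using strict_mono_on_imp_inj_on[OF fibo_strict_mono] by (rule inj_on_subset) (use S in auto)
  moreover have "finite S" using S finite_subset by blast
  ultimately show "Q \<in> fib_partitions n"
    using S by (auto simp: fib_partitions_def sum.reindex)
qed

lemma sum_fib_partitions_eq_bounded_gf:
  assumes "n \<le> k"
  shows "(\<Sum>Q\<in>fib_partitions n. t ^ card Q) = bounded_gf t k n"
proof -
  have sub: "S \<subseteq> {1..}" if "S \<in> index_sets k n" for S
    using that by (auto simp: index_sets_def)
  have inj: "inj_on fibo {1..}" using strict_mono_on_imp_inj_on[OF fibo_strict_mono] .
  have "inj_on (image fibo) (index_sets k n)"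
    using inj_on_image_eq_iff[OF inj] sub by (auto intro: inj_onI)
  moreover have "card (fibo ` S) = card S" if "S \<in> index_sets k n" for S
    using card_image[OF inj_on_subset[OF inj sub[OF that]]] .
  ultimately show ?thesis
    by (simp add: fib_partitions_eq_image[OF assms] sum.reindex bounded_gf_def)
qed

text \<open>Group the partitions by their number of parts. Positivity of \<open>n\<close> rules out
  the empty partition, whose term t^0 is absent from \<open>Phi n\<close>.\<close>

lemma poly_Phi:
  fixes t :: "'a::{comm_ring_1,ring_char_0}"
  assumes "n > 0"
  shows "poly (map_poly of_int (Phi n)) t = (\<Sum>Q\<in>fib_partitions n. t ^ card Q)"
proof -
  have card_in: "card Q \<in> {1..n}" if Q: "Q \<in> fib_partitions n" for Q
  proof -
    have "card Q \<le> n" using card_mono[OF _ fib_partition_subset[OF Q]] by simp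
    moreover have "finite Q" "Q \<noteq> {}" using Q assms by (auto simp: fib_partitions_def)
    then have "card Q > 0" by (simp add: card_gt_0_iff)
    ultimately show ?thesis by simp
  qed
  have "map_poly of_int (Phi n) = (\<Sum>h = 1..n. monom (of_nat (Phi_parts h n) :: 'a) h)"
    by (rule poly_eqI) (simp add: coeff_map_poly Phi_def coeff_sum if_distrib cong: if_cong)
  then have "poly (map_poly of_int (Phi n)) t = (\<Sum>h = 1..n. of_nat (Phi_parts h n) * t ^ h)"
    by (simp add: poly_sum poly_monom)
  also have "\<dots> = (\<Sum>h = 1..n. \<Sum>Q\<in>{Q \<in> fib_partitions n. card Q = h}. t ^ card Q)"
    by (simp add: Phi_parts_def)
  also have "\<dots> = (\<Sum>Q\<in>fib_partitions n. t ^ card Q)"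
    by (rule sum.group) (use finite_fib_partitions card_in in auto)
  finally show ?thesis .
qed

section \<open>Residue sums and the modulus at \<open>omega\<close>\<close>

lemma poly_omega_eq_residue_sums:
  "poly (map_poly of_int g) omega =
     of_int (residue_sum 0 g) + of_int (residue_sum 1 g) * omega + of_int (residue_sum 2 g) * omega\<^sup>2"
proof -
  have deg: "degree (map_poly of_int g :: complex poly) = degree g"
    by (rule degree_map_poly) simp
  \<comment> \<open>Exponents matter only modulo 3, so the value at \<open>omega\<close> is
    determined by the residue sums.\<close>
  have pow: "omega ^ h = omega ^ (h mod 3)" for h
  proof -
    have "omega ^ h = omega ^ (3 * (h div 3) + h mod 3)" by simp
    then show ?thesis by (simp only: power_add power_mult omega_cubed power_one mult_1)
  qed
  have "poly (map_poly of_int g) omega = (\<Sum>h\<le>degree g. of_int (coeff g h) * omega ^ h)"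
    by (simp add: poly_altdef deg coeff_map_poly)
  also have "\<dots> = (\<Sum>i\<in>{0,1,2}. \<Sum>h\<in>{h \<in> {..degree g}. h mod 3 = i}. of_int (coeff g h) * omega ^ h)"
    by (rule sum.group[symmetric]) auto
  also have "\<dots> = (\<Sum>i\<in>{0,1,2}. of_int (residue_sum i g) * omega ^ i)"
  proof (rule sum.cong)
    fix i :: nat
    have "(\<Sum>h\<in>{h \<in> {..degree g}. h mod 3 = i}. of_int (coeff g h) * omega ^ h) =
        (\<Sum>h\<in>{h \<in> {..degree g}. h mod 3 = i}. of_int (coeff g h) * omega ^ i)"
      by (rule sum.cong) (use pow in auto)
    then show "(\<Sum>h\<in>{h \<in> {..degree g}. h mod 3 = i}. of_int (coeff g h) * omega ^ h) =
        of_int (residue_sum i g) * omega ^ i"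
      by (simp add: residue_sum_def sum_distrib_right)
  qed simp
  finally show ?thesis by simp
qed

text \<open>The squared modulus is the norm form a^2 + b^2 + c^2 - ab - bc - ca; doubling it gives a
  sum of squares.\<close>

lemma cmod_omega_combination:
  "2 * (cmod (of_int a + of_int b * omega + of_int c * omega\<^sup>2))\<^sup>2 =
     of_int ((a - b)\<^sup>2 + (b - c)\<^sup>2 + (a - c)\<^sup>2)"
proof -
  have "of_int a + of_int b * omega + of_int c * omega\<^sup>2 =
      Complex (of_int a - (of_int b + of_int c) / 2) ((of_int b - of_int c) * sqrt 3 / 2)"
    unfolding omega_square by (simp add: omega_def complex_eq_iff field_simps)
  then show ?thesis
    by (simp add: cmod_def power_divide power_mult_distrib) (simp add: power2_eq_square field_simps)
qed

lemma three_specialI: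
  assumes "cmod (poly (map_poly of_int g) omega) \<in> {0, 1}"
  shows "three_special g"
proof -
  define a b c where "a = residue_sum 0 g" and "b = residue_sum 1 g" and "c = residue_sum 2 g"
  define s where "s = (a - b)\<^sup>2 + (b - c)\<^sup>2 + (a - c)\<^sup>2"
  have "(of_int s :: real) \<in> {0, 2}"
    using assms cmod_omega_combination[of a b c]
    unfolding poly_omega_eq_residue_sums s_def a_def b_def c_def by auto
  then have "s = 0 \<or> s = 2" by auto
  then have "a = b \<and> b = c \<or> \<bar>a - b\<bar> + \<bar>a - c\<bar> + \<bar>b - c\<bar> = 2"
  proof
    assume "s = 0"
    then show ?thesis by (simp add: s_def add_nonneg_eq_0_iff)
  next
    assume s2: "s = 2"
    have small: "x \<in> {-1, 0, 1}" if "x\<^sup>2 \<le> 2" for x :: int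
    proof -
      have "\<bar>x\<bar> < 2" by (rule power2_less_imp_less) (use that in auto)
      then show ?thesis by auto
    qed
    have "(a - b)\<^sup>2 \<le> 2" "(b - c)\<^sup>2 \<le> 2" "(a - c)\<^sup>2 \<le> 2"
      using s2 zero_le_power2[of "a - b"] zero_le_power2[of "b - c"] zero_le_power2[of "a - c"]
      unfolding s_def by linarith+
    then have "a - b \<in> {-1, 0, 1}" "b - c \<in> {-1, 0, 1}" "a - c \<in> {-1, 0, 1}"
      using small by blast+
    \<comment> \<open>On {-1, 0, 1} absolute values and squares coincide, so the absolute
      differences also add up to 2.\<close>
    then show ?thesis using s2 by (auto simp: s_def)
  qed
  then show ?thesis
    unfolding three_special_def special_def R_map_def a_def b_def c_def by blast
qed

theorem theorem6:
  fixes n :: nat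
  assumes "n > 0"
  shows "three_special (Phi n)"
proof (rule three_specialI)
  \<comment> \<open>The bound k = n + 1 serves twice: n < f_k makes the line lemma applicable, and n
    \<le> k admits every partition of \<open>n\<close>.\<close>
  have "n < fibo (Suc n)" using fibo_ge[of "Suc n"] by simp
  then have "cmod (bounded_gf omega (Suc n) n) \<in> {0, 1}"
    using on_unit_line_bounded_gf on_unit_line_cmod by blast
  then show "cmod (poly (map_poly of_int (Phi n)) omega) \<in> {0, 1}"
    using assms by (simp add: poly_Phi sum_fib_partitions_eq_bounded_gf[of n "Suc n"])
qed

end
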